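(* Let $r>3$, $L>0$, $0<s\le 1/L$, and let $f=g+h$ where $g\in\mathcal{F}_L$ and $h:\mathbb{R}^n\to(-\infty,\infty]$ is convex. Let $x^\star$ be a minimizer of $f$, $f^\star=f(x^\star)$, let $x_0\in\mathbb{R}^n$, and let $\{x_k\}$ be given by $y_0=x_0$ and, for $k\ge1$, $$x_k=y_{k-1}-sG_s(y_{k-1}),\qquad y_k=x_k+\frac{k-1}{k+r-1}(x_k-x_{k-1}).$$ Then for every $k\ge 1$ $$f(x_k)-f^\star\le\frac{(r-1)^2\|x_0-x^\star\|^2}{2s(k+r-2)^2},$$ and $$\sum_{k=1}^\infty (k+r-1)\bigl(f(x_k)-f^\star\bigr)\le\frac{(r-1)^2\|x_0-x^\star\|^2}{2s(r-3)} .$$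
   Context: $\|\cdot\|$ is the Euclidean norm on $\mathbb{R}^n$. $\mathcal{F}_L$ is the class of convex continuously differentiable functions $g:\mathbb{R}^n\to\mathbb{R}$ with $\|\nabla g(x)-\nabla g(y)\|\le L\|x-y\|$ for all $x,y\in\mathbb{R}^n$. The proximal subgradient is $$G_s(x)=\frac{x-\operatorname{argmin}_{z}\left(\|z-(x-s\nabla g(x))\|^2/(2s)+h(z)\right)}{s},$$ where it is implicit that $h$ is such that the (unique) minimizer over $z\in\mathbb{R}^n$ exists for every $x$ (e.g. $h$ proper and lower semicontinuous). *)

theory Defs
  imports "HOL-Analysis.Analysis"
begin

definition grad :: "('a::real_inner \<Rightarrow> real) \<Rightarrow> 'a \<Rightarrow> 'a" where
  "grad g x = (THE d. GDERIV g x :> d)"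

definition convex_smooth_class :: "real \<Rightarrow> ('a::real_inner \<Rightarrow> real) set" where
  "convex_smooth_class L = {g. convex_on UNIV g \<and>
     (\<forall>x. g differentiable at x) \<and> continuous_on UNIV (grad g) \<and>
     (\<forall>x y. norm (grad g x - grad g y) \<le> L * norm (x - y))}"

(* Intended for functions that do not take the value -\<infinity>. In ereal, 0 * \<infinity> = 0, so the
   inequality is trivially true for u = 0 or v = 0. *)
definition ereal_convex :: "('a::real_vector \<Rightarrow> ereal) \<Rightarrow> bool" where
  "ereal_convex h \<longleftrightarrow> (\<forall>x y. \<forall>u\<ge>0. \<forall>v\<ge>0. u + v = 1 \<longrightarrow>
     h (u *\<^sub>R x + v *\<^sub>R y) \<le> ereal u * h x + ereal v * h y)"

definition prox_objective ::
  "real \<Rightarrow> ('a::real_inner \<Rightarrow> real) \<Rightarrow> ('a \<Rightarrow> ereal) \<Rightarrow> 'a \<Rightarrow> 'a \<Rightarrow> ereal" where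
  "prox_objective s g h x z =
     ereal ((norm (z - (x - s *\<^sub>R grad g x)))\<^sup>2 / (2 * s)) + h z"

definition prox_subgrad ::
  "real \<Rightarrow> ('a::real_inner \<Rightarrow> real) \<Rightarrow> ('a \<Rightarrow> ereal) \<Rightarrow> 'a \<Rightarrow> 'a" where
  "prox_subgrad s g h x = (x - arg_min (prox_objective s g h x) (\<lambda>_. True)) /\<^sub>R s"

end

(*
  Convexity and the descent lemma for g together with the optimality condition of the proximal
  step give, for y - s G the proximal step from y and for every z,
    f (y - s G) <= f z + <G, y - z> - (s/2) |G|^2.
  Put d_k = f (x_k) - f*, z_k = ((k+r-1) y_k - k x_k) / (r-1), so z_{k+1} = z_k - s (k+r-1)/(r-1) G.
  Averaging the inequality at z = x_k and z = x* with weights k/(k+r-1) and (r-1)/(k+r-1) yields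
    (k+r-1)^2 d_{k+1} + c |z_{k+1} - x*|^2 <= k (k+r-1) d_k + c |z_k - x*|^2,
  where c = (r-1)^2/(2s). For k = 0 the term d_0 disappears, which matters because it may be
  infinite. For k >= 1 one has k (k+r-1) <= (k+r-2)^2 - (r-3)(k+r-1), so the left-hand side is a
  Lyapunov function whose decrease controls the series.
*)
theory Submission
  imports Defs
begin

section \<open>Gradients, tangent planes and the descent lemma\<close>

lemma GDERIV_grad:
  fixes g :: "'a::euclidean_space \<Rightarrow> real"
  assumes "g differentiable at x"
  shows "GDERIV g x :> grad g x"
proof -
  obtain g' where g': "(g has_derivative g') (at x)"
    using assms by (auto simp: differentiable_def)
  have lin: "linear g'"
    using g' by (simp add: has_derivative_linear)
  \<comment> \<open>Riesz representation: the adjoint of a linear functional, evaluated at 1, is the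
    vector that represents it.\<close>
  have "g' = (\<lambda>v. v \<bullet> adjoint g' 1)"
    using adjoint_works[OF lin, of _ 1] by (simp add: fun_eq_iff)
  with g' have ex: "GDERIV g x :> adjoint g' 1"
    by (simp add: gderiv_def)
  have uniq: "d = adjoint g' 1" if "GDERIV g x :> d" for d
  proof -
    have "(\<lambda>v. v \<bullet> d) = (\<lambda>v. v \<bullet> adjoint g' 1)"
      using that ex unfolding gderiv_def by (rule has_derivative_unique)
    then have "\<And>v. v \<bullet> d = v \<bullet> adjoint g' 1"
      by (rule fun_cong)
    then show ?thesis
      by (metis vector_eq_ldot)
  qed
  show ?thesis
    unfolding grad_def using ex uniq by (rule theI)
qed

lemma GDERIV_imp_has_real_derivative_line:
  assumes "GDERIV g (y + t *\<^sub>R d) :> D"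
  shows "((\<lambda>t. g (y + t *\<^sub>R d)) has_real_derivative D \<bullet> d) (at t)"
proof -
  have line: "((\<lambda>t. y + t *\<^sub>R d) has_derivative (\<lambda>u. u *\<^sub>R d)) (at t)"
    by (auto intro!: derivative_eq_intros)
  have "((\<lambda>t. g (y + t *\<^sub>R d)) has_derivative (\<lambda>u. (u *\<^sub>R d) \<bullet> D)) (at t)"
    using has_derivative_compose[OF line, of g "\<lambda>v. v \<bullet> D"] assms by (simp add: gderiv_def)
  then show ?thesis
    by (simp add: has_field_derivative_def inner_commute mult.commute[of _ "D \<bullet> d"])
qed

text \<open>Restriction to the line through \<open>y\<close> and \<open>z\<close> reduces this to
  the tangent inequality in one variable.\<close>

lemma convex_on_imp_above_gradient:
  assumes "convex_on UNIV g" and "GDERIV g y :> D"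
  shows "g y + D \<bullet> (z - y) \<le> g z"
proof -
  let ?\<phi> = "\<lambda>t. g (y + t *\<^sub>R (z - y))"
  have "convex_on UNIV ?\<phi>"
  proof (rule convex_onI)
    fix t a b :: real
    assume t: "0 < t" "t < 1"
    have "y + ((1 - t) *\<^sub>R a + t *\<^sub>R b) *\<^sub>R (z - y)
        = (1 - t) *\<^sub>R (y + a *\<^sub>R (z - y)) + t *\<^sub>R (y + b *\<^sub>R (z - y))"
      by (simp add: algebra_simps)
    then show "?\<phi> ((1 - t) *\<^sub>R a + t *\<^sub>R b) \<le> (1 - t) * ?\<phi> a + t * ?\<phi> b"
      using convex_onD[OF assms(1), of t] t by simp
  qed simp
  moreover have "(?\<phi> has_real_derivative D \<bullet> (z - y)) (at 0)"
    using GDERIV_imp_has_real_derivative_line[of g y 0 "z - y" D] assms(2) by simp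
  ultimately have "?\<phi> 1 - ?\<phi> 0 \<ge> D \<bullet> (z - y) * (1 - 0)"
    by (intro convex_on_imp_above_tangent[of UNIV]) auto
  then show ?thesis
    by simp
qed

text \<open>Along the segment from \<open>y\<close> to \<open>z\<close>, \<open>g\<close> minus its
  quadratic model has nonpositive derivative by Cauchy-Schwarz and the Lipschitz bound; monotonicity
  replaces integration of the gradient.\<close>

lemma lipschitz_gradient_descent:
  assumes deriv: "\<And>u. GDERIV g u :> D u"
    and lip: "\<And>u v. norm (D u - D v) \<le> L * norm (u - v)"
  shows "g z \<le> g y + D y \<bullet> (z - y) + L / 2 * (norm (z - y))\<^sup>2"
proof -
  define d where "d = z - y"
  let ?\<phi> = "\<lambda>t. g (y + t *\<^sub>R d) - t * (D y \<bullet> d) - L / 2 * t\<^sup>2 * (norm d)\<^sup>2"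
  have "?\<phi> 1 \<le> ?\<phi> 0"
  proof (rule DERIV_nonpos_imp_nonincreasing[where f = ?\<phi>])
    fix t :: real
    assume t: "0 \<le> t" "t \<le> 1"
    let ?m = "D (y + t *\<^sub>R d) \<bullet> d - D y \<bullet> d - L * t * (norm d)\<^sup>2"
    have "(?\<phi> has_real_derivative ?m) (at t)"
      by (auto intro!: derivative_eq_intros
            GDERIV_imp_has_real_derivative_line[OF deriv])
    moreover have "?m \<le> 0"
    proof -
      have "(D (y + t *\<^sub>R d) - D y) \<bullet> d \<le> norm (D (y + t *\<^sub>R d) - D y) * norm d"
        by (rule norm_cauchy_schwarz)
      also have "\<dots> \<le> L * norm (t *\<^sub>R d) * norm d"
        using lip[of "y + t *\<^sub>R d" y] by (intro mult_right_mono) simp_all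
      also have "\<dots> = L * t * (norm d)\<^sup>2"
        using t by (simp add: power2_eq_square)
      finally show ?thesis
        by (simp add: inner_diff_left)
    qed
    ultimately show "\<exists>m. (?\<phi> has_real_derivative m) (at t) \<and> m \<le> 0"
      by blast
  qed simp
  then show ?thesis
    by (simp add: d_def)
qed

text \<open>The descent lemma bounds \<open>g p\<close> by the model at \<open>y\<close>, and
  convexity bounds the linear part at \<open>y\<close> by \<open>g z\<close>, so \<open>g y\<close>
  cancels. The step size condition turns L/2 into 1/(2s).\<close>

lemma convex_smooth_class_upper_bound:
  fixes g :: "'a::euclidean_space \<Rightarrow> real"
  assumes g: "g \<in> convex_smooth_class L" and "0 < L" "0 < s" "s \<le> 1 / L"
  shows "g p \<le> g z + grad g y \<bullet> (p - z) + (norm (p - y))\<^sup>2 / (2 * s)"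
proof -
  have deriv: "\<And>u. GDERIV g u :> grad g u"
    using g by (auto simp: convex_smooth_class_def intro: GDERIV_grad)
  have "g p \<le> g y + grad g y \<bullet> (p - y) + L / 2 * (norm (p - y))\<^sup>2"
    using g by (intro lipschitz_gradient_descent deriv) (auto simp: convex_smooth_class_def)
  moreover have "g y + grad g y \<bullet> (z - y) \<le> g z"
    using g by (intro convex_on_imp_above_gradient deriv) (auto simp: convex_smooth_class_def)
  moreover have "L / 2 * (norm (p - y))\<^sup>2 \<le> 1 / (2 * s) * (norm (p - y))\<^sup>2"
    using assms by (intro mult_right_mono) (auto simp: field_simps)
  ultimately show ?thesis
    by (simp add: inner_diff_right)
qed

section \<open>The proximal step and its optimality condition\<close>

lemma is_arg_min_finite:
  fixes \<phi> :: "'a::euclidean_space \<Rightarrow> real" and h :: "'a \<Rightarrow> ereal"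
  assumes "\<And>z. h z \<noteq> -\<infinity>" and "h q \<noteq> \<infinity>"
    and "is_arg_min (\<lambda>z. ereal (\<phi> z) + h z) (\<lambda>_. True) p"
  shows "\<bar>h p\<bar> \<noteq> \<infinity>"
proof -
  have "ereal (\<phi> p) + h p \<le> ereal (\<phi> q) + h q"
    using assms(3) by (auto simp: is_arg_min_def not_less)
  then show ?thesis
    using assms(1)[of p] assms(1)[of q] assms(2)
    by (cases "h p"; cases "h q") auto
qed

lemma norm_add_scaleR_power2:
  fixes a b :: "'a::real_inner"
  shows "(norm (a + t *\<^sub>R b))\<^sup>2 = (norm a)\<^sup>2 + 2 * t * (a \<bullet> b) + t\<^sup>2 * (norm b)\<^sup>2"
  unfolding power2_norm_eq_inner
  by (simp add: inner_add_left inner_add_right inner_commute[of b a] power2_eq_square distrib_left)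

text \<open>This says that (w - p)/s is a subgradient of \<open>h\<close> at \<open>p\<close>. The
  minimizer is compared with the point (1 - t) p + t z; convexity of \<open>h\<close> leaves a
  common factor t, which is divided out before t tends to 0 from the right.\<close>

lemma prox_optimality:
  fixes h :: "'a::real_inner \<Rightarrow> ereal"
  assumes conv: "ereal_convex h" and "0 < s"
    and min: "\<And>z. ereal ((norm (p - w))\<^sup>2 / (2 * s)) + h p
                \<le> ereal ((norm (z - w))\<^sup>2 / (2 * s)) + h z"
    and hp: "h p = ereal a" and hz: "h z = ereal b"
  shows "a + (w - p) \<bullet> (z - p) / s \<le> b"
proof -
  let ?e = "\<lambda>t. (p - w) \<bullet> (z - p) / s + t * ((norm (z - p))\<^sup>2 / (2 * s)) + b"
  have ineq: "a \<le> ?e t" if t: "0 < t" "t < 1" for t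
  proof -
    let ?z = "(1 - t) *\<^sub>R p + t *\<^sub>R z"
    have "ereal ((norm (p - w))\<^sup>2 / (2 * s)) + h p \<le> ereal ((norm (?z - w))\<^sup>2 / (2 * s)) + h ?z"
      by (rule min)
    also have "h ?z \<le> ereal (1 - t) * h p + ereal t * h z"
      using conv t by (simp add: ereal_convex_def)
    finally have le: "(norm (p - w))\<^sup>2 / (2 * s) + a
        \<le> (norm (?z - w))\<^sup>2 / (2 * s) + ((1 - t) * a + t * b)"
      by (simp add: hp hz add_left_mono)
    have "?z - w = (p - w) + t *\<^sub>R (z - p)"
      by (simp add: algebra_simps)
    then have "(norm (?z - w))\<^sup>2
        = (norm (p - w))\<^sup>2 + 2 * t * ((p - w) \<bullet> (z - p)) + t\<^sup>2 * (norm (z - p))\<^sup>2"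
      by (simp only: norm_add_scaleR_power2)
    then have "(norm (?z - w))\<^sup>2 / (2 * s) = (norm (p - w))\<^sup>2 / (2 * s)
        + t * ((p - w) \<bullet> (z - p) / s + t * ((norm (z - p))\<^sup>2 / (2 * s)))"
      using \<open>0 < s\<close> by (simp add: field_simps power2_eq_square)
    with le have "t * a \<le> t * ?e t"
      by (simp add: algebra_simps)
    then show ?thesis
      using t by simp
  qed
  have "(?e \<longlongrightarrow> ?e 0) (at_right 0)"
    by (intro tendsto_intros)
  moreover have "\<forall>\<^sub>F t in at_right 0. a \<le> ?e t"
    using eventually_at_right_real[of 0 "1::real"]
    by (rule eventually_mono) (use ineq in auto)
  ultimately have "a \<le> ?e 0"
    by (intro tendsto_lowerbound[where F = "at_right (0::real)"]) auto
  moreover have "(p - w) \<bullet> (z - p) / s = - ((w - p) \<bullet> (z - p) / s)"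
    by (simp add: inner_diff_left diff_divide_distrib)
  ultimately show ?thesis
    by simp
qed

text \<open>The subgradient of \<open>h\<close> at \<open>p\<close> is \<open>G - grad g y\<close>,
  so adding the upper bound for \<open>g\<close> cancels the gradient terms. Rewriting
  \<open>p\<close> as a step from \<open>y\<close> contributes -s |G|^2, of which the quadratic term
  s/2 |G|^2 takes back half.\<close>

lemma proximal_gradient_inequality:
  fixes g :: "'a::euclidean_space \<Rightarrow> real" and h :: "'a \<Rightarrow> ereal"
  assumes g: "g \<in> convex_smooth_class L" and s: "0 < L" "0 < s" "s \<le> 1 / L"
    and conv: "ereal_convex h"
    and min: "is_arg_min (prox_objective s g h y) (\<lambda>_. True) p"
    and hp: "h p = ereal a" and hz: "h z = ereal b" and G: "p = y - s *\<^sub>R G"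
  shows "g p + a \<le> g z + b + G \<bullet> (y - z) - s / 2 * (norm G)\<^sup>2"
proof -
  let ?w = "y - s *\<^sub>R grad g y"
  have "prox_objective s g h y p \<le> prox_objective s g h y u" for u
    using min by (auto simp: is_arg_min_def not_less)
  then have "a + (?w - p) \<bullet> (z - p) / s \<le> b"
    by (intro prox_optimality[OF conv s(2) _ hp hz]) (simp add: prox_objective_def)
  also have "(?w - p) \<bullet> (z - p) / s = (G - grad g y) \<bullet> (z - p)"
  proof -
    have "?w - p = s *\<^sub>R (G - grad g y)"
      by (simp add: G algebra_simps)
    then show ?thesis
      using s(2) by simp
  qed
  finally have "a + (G - grad g y) \<bullet> (z - p) \<le> b" .
  moreover have "g p \<le> g z + grad g y \<bullet> (p - z) + (norm (p - y))\<^sup>2 / (2 * s)"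
    by (rule convex_smooth_class_upper_bound[OF g s])
  moreover have "(norm (p - y))\<^sup>2 / (2 * s) = s / 2 * (norm G)\<^sup>2"
    using s(2) by (simp add: G power2_eq_square)
  moreover have "G \<bullet> (z - p) = - (G \<bullet> (y - z)) + s * (norm G)\<^sup>2"
    by (simp add: G inner_diff_right power2_norm_eq_inner)
  ultimately show ?thesis
    by (simp add: inner_diff_left inner_diff_right algebra_simps)
qed

section \<open>Decrease of the Lyapunov function\<close>

text \<open>Here \<open>\<kappa>\<close> is the iteration index. The point \<open>z\<close> is
  chosen so that the weighted sum of \<open>old\<close> and \<open>opt\<close> involves
  \<open>y\<close>, \<open>x\<close> and \<open>xs\<close> only through
  \<open>G \<bullet> (z - xs)\<close>. The factor \<open>\<kappa>\<close> in \<open>old\<close>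
  keeps the lemma applicable at index 0, where no relation between \<open>\<delta>'\<close> and
  \<open>\<delta>\<close> is available.\<close>

lemma accelerated_step:
  fixes y G x xs :: "'a::real_inner"
  assumes "1 < r" "0 < s" "0 \<le> \<kappa>"
    and old: "\<kappa> * \<delta>' \<le> \<kappa> * (\<delta> + G \<bullet> (y - x) - s / 2 * (norm G)\<^sup>2)"
    and opt: "\<delta>' \<le> G \<bullet> (y - xs) - s / 2 * (norm G)\<^sup>2"
    and z: "z = ((\<kappa> + r - 1) *\<^sub>R y - \<kappa> *\<^sub>R x) /\<^sub>R (r - 1)"
    and z': "z' = z - (s * (\<kappa> + r - 1) / (r - 1)) *\<^sub>R G"
  shows "(\<kappa> + r - 1)\<^sup>2 * \<delta>' + (r - 1)\<^sup>2 / (2 * s) * (norm (z' - xs))\<^sup>2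
    \<le> \<kappa> * (\<kappa> + r - 1) * \<delta> + (r - 1)\<^sup>2 / (2 * s) * (norm (z - xs))\<^sup>2"
proof -
  define m where "m = \<kappa> + r - 1"
  define I where "I = G \<bullet> (z - xs)"
  have m: "0 < m"
    using assms by (simp add: m_def)
  have "(r - 1) *\<^sub>R z = m *\<^sub>R y - \<kappa> *\<^sub>R x"
    using \<open>1 < r\<close> by (simp add: z m_def)
  then have "(r - 1) *\<^sub>R (z - xs) = \<kappa> *\<^sub>R (y - x) + (r - 1) *\<^sub>R (y - xs)"
    by (simp add: m_def algebra_simps)
  then have "G \<bullet> ((r - 1) *\<^sub>R (z - xs)) = G \<bullet> (\<kappa> *\<^sub>R (y - x) + (r - 1) *\<^sub>R (y - xs))"
    by simp
  then have I: "(r - 1) * I = \<kappa> * (G \<bullet> (y - x)) + (r - 1) * (G \<bullet> (y - xs))"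
    by (simp add: I_def inner_add_right)
  have opt': "(r - 1) * \<delta>' \<le> (r - 1) * (G \<bullet> (y - xs) - s / 2 * (norm G)\<^sup>2)"
    using opt \<open>1 < r\<close> by (intro mult_left_mono) auto
  have m_split: "m * t = \<kappa> * t + (r - 1) * t" for t
    by (simp add: m_def algebra_simps)
  have "m * \<delta>' \<le> \<kappa> * \<delta> + (r - 1) * I - m * (s / 2 * (norm G)\<^sup>2)"
    using old opt' I m_split[of \<delta>'] m_split[of "s / 2 * (norm G)\<^sup>2"]
    unfolding right_diff_distrib distrib_left by linarith
  then have "m * (m * \<delta>') \<le> m * (\<kappa> * \<delta> + (r - 1) * I - m * (s / 2 * (norm G)\<^sup>2))"
    using m by (intro mult_left_mono) auto
  \<comment> \<open>The factor in front of the squared distance makes its expansion produce exactly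
    the \<open>I\<close> and |G|^2 terms of the previous inequality with opposite sign, so both
    cancel in the sum.\<close>
  moreover have "(r - 1)\<^sup>2 / (2 * s) * (norm (z' - xs))\<^sup>2
      = (r - 1)\<^sup>2 / (2 * s) * (norm (z - xs))\<^sup>2 - m * (r - 1) * I + m\<^sup>2 * (s / 2 * (norm G)\<^sup>2)"
  proof -
    have "z' - xs = (z - xs) + (- (s * m / (r - 1))) *\<^sub>R G"
      by (simp add: z' m_def)
    then have "(norm (z' - xs))\<^sup>2 = (norm (z - xs))\<^sup>2 - 2 * (s * m / (r - 1)) * I
        + (s * m / (r - 1))\<^sup>2 * (norm G)\<^sup>2"
      by (simp only: norm_add_scaleR_power2) (simp add: I_def inner_commute)
    moreover have "q\<^sup>2 / (2 * s) * (A - 2 * (s * m / q) * I + (s * m / q)\<^sup>2 * B)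
        = q\<^sup>2 / (2 * s) * A - m * q * I + m\<^sup>2 * (s / 2 * B)" if "q \<noteq> 0" for q A B
      using that \<open>0 < s\<close> by (simp add: field_simps power2_eq_square)
    ultimately show ?thesis
      using \<open>1 < r\<close> by simp
  qed
  ultimately show ?thesis
    by (simp add: m_def[symmetric] power2_eq_square algebra_simps)
qed

text \<open>The partial sum is carried inside the induction, so that a single invariant gives both
  bounds once nonnegative terms are dropped.\<close>

lemma lyapunov_bounds:
  fixes \<delta> Z :: "nat \<Rightarrow> real"
  assumes r: "3 < r" and nonneg: "\<And>k. 0 \<le> \<delta> k" "\<And>k. 0 \<le> Z k"
    and step: "\<And>k. (real k + r - 1)\<^sup>2 * \<delta> (Suc k) + Z (Suc k)
                 \<le> real k * (real k + r - 1) * \<delta> k + Z k"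
  shows "(real k + r - 1)\<^sup>2 * \<delta> (Suc k) \<le> Z 0"
    and "(r - 3) * (\<Sum>j<k. (real (Suc j) + r - 1) * \<delta> (Suc j)) \<le> Z 0"
proof -
  let ?S = "\<lambda>k. (r - 3) * (\<Sum>j<k. (real (Suc j) + r - 1) * \<delta> (Suc j))"
  have energy: "(real k + r - 1)\<^sup>2 * \<delta> (Suc k) + Z (Suc k) + ?S k \<le> Z 0" for k
  proof (induction k)
    case 0
    then show ?case
      using step[of 0] by simp
  next
    case (Suc k)
    \<comment> \<open>The right side exceeds the left by exactly 1.\<close>
    have "real (Suc k) * (real (Suc k) + r - 1)
        \<le> (real k + r - 1)\<^sup>2 - (r - 3) * (real (Suc k) + r - 1)"
      by (simp add: power2_eq_square algebra_simps)
    then have "real (Suc k) * (real (Suc k) + r - 1) * \<delta> (Suc k)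
        \<le> ((real k + r - 1)\<^sup>2 - (r - 3) * (real (Suc k) + r - 1)) * \<delta> (Suc k)"
      using nonneg(1) by (rule mult_right_mono)
    moreover have "?S (Suc k) = ?S k + (r - 3) * (real (Suc k) + r - 1) * \<delta> (Suc k)"
      by (simp add: algebra_simps)
    ultimately show ?case
      using step[of "Suc k"] Suc.IH by (simp add: left_diff_distrib)
  qed
  have "0 \<le> ?S k"
    using r nonneg by (intro mult_nonneg_nonneg sum_nonneg) auto
  then show "(real k + r - 1)\<^sup>2 * \<delta> (Suc k) \<le> Z 0"
    using energy[of k] nonneg(2)[of "Suc k"] by linarith
  have "0 \<le> (real k + r - 1)\<^sup>2 * \<delta> (Suc k)"
    using nonneg by simp
  then show "?S k \<le> Z 0"
    using energy[of k] nonneg(2)[of "Suc k"] by linarith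
qed

section \<open>Convergence of the accelerated proximal gradient iteration\<close>

theorem theorem6:
  fixes g :: "real ^ 'n \<Rightarrow> real" and h f :: "real ^ 'n \<Rightarrow> ereal"
    and x y :: "nat \<Rightarrow> real ^ 'n" and x0 xstar :: "real ^ 'n" and r L s :: real
  assumes "r > 3" and "L > 0" and "0 < s" and "s \<le> 1 / L"
    and "g \<in> convex_smooth_class L"
    and "\<And>z. h z \<noteq> -\<infinity>" and "ereal_convex h"
    and "\<And>v. \<exists>!z. is_arg_min (prox_objective s g h v) (\<lambda>_. True) z"
    and "\<And>z. f z = ereal (g z) + h z"
    and "is_arg_min f (\<lambda>_. True) xstar"
    and "x 0 = x0" and "y 0 = x0"
    and "\<And>k. k \<ge> 1 \<Longrightarrow> x k = y (k - 1) - s *\<^sub>R prox_subgrad s g h (y (k - 1))"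
    and "\<And>k. k \<ge> 1 \<Longrightarrow>
           y k = x k + ((real k - 1) / (real k + r - 1)) *\<^sub>R (x k - x (k - 1))"
  shows "(\<forall>k\<ge>1. f (x k) - f xstar
            \<le> ereal ((r - 1)\<^sup>2 * (norm (x0 - xstar))\<^sup>2 / (2 * s * (real k + r - 2)\<^sup>2))) \<and>
         (\<Sum>k. ereal (real (Suc k) + r - 1) * (f (x (Suc k)) - f xstar))
            \<le> ereal ((r - 1)\<^sup>2 * (norm (x0 - xstar))\<^sup>2 / (2 * s * (r - 3)))"
proof -
  note r = assms(1) and s = assms(2-4) and g = assms(5) and h_minf = assms(6) and conv = assms(7)
    and f = assms(9) and xstar = assms(10) and init = assms(11,12) and x_rec = assms(13)
    and y_rec = assms(14)
  \<comment> \<open>Properness of \<open>h\<close> follows from uniqueness of proximal points: if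
    \<open>h\<close> were infinite everywhere, every point would be a minimizer, yet the space has
    two distinct points.\<close>
  obtain q where q: "h q \<noteq> \<infinity>"
  proof (rule ccontr)
    assume "\<not> thesis"
    with that have "h z = \<infinity>" for z
      by blast
    then have "is_arg_min (prox_objective s g h 0) (\<lambda>_. True) z" for z
      by (simp add: is_arg_min_def prox_objective_def)
    then have "z = z'" for z z' :: "real ^ 'n"
      using assms(8)[of 0] by blast
    then have "(1 :: real ^ 'n) = 0"
      by blast
    then show False
      by simp
  qed
  let ?p = "\<lambda>v. v - s *\<^sub>R prox_subgrad s g h v"
  \<comment> \<open>\<open>arg_min\<close> chooses some minimizer, so existence makes it one;
    multiplying by \<open>s\<close> undoes the division in \<open>prox_subgrad\<close>.\<close>
  have p_min: "is_arg_min (prox_objective s g h v) (\<lambda>_. True) (?p v)" for v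
  proof -
    have "\<exists>z. is_arg_min (prox_objective s g h v) (\<lambda>_. True) z"
      using assms(8)[of v] by blast
    then have "is_arg_min (prox_objective s g h v) (\<lambda>_. True)
        (arg_min (prox_objective s g h v) (\<lambda>_. True))"
      unfolding arg_min_def by (rule someI_ex)
    then show ?thesis
      using \<open>0 < s\<close> by (simp add: prox_subgrad_def)
  qed
  have p_fin: "\<bar>h (?p v)\<bar> \<noteq> \<infinity>" for v
    using is_arg_min_finite[where h = h, OF h_minf q] p_min[of v] unfolding prox_objective_def .
  have xstar_fin: "\<bar>h xstar\<bar> \<noteq> \<infinity>"
    using is_arg_min_finite[where h = h and \<phi> = g, OF h_minf q] xstar f by (simp add: is_arg_min_def)
  have x_Suc: "x (Suc k) = ?p (y k)" for k
    using x_rec[of "Suc k"] by simp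
  define hr where "hr v = real_of_ereal (h v)" for v
  have hr: "h v = ereal (hr v)" if "\<bar>h v\<bar> \<noteq> \<infinity>" for v
    using that by (simp add: hr_def ereal_real)
  have h_star: "h xstar = ereal (hr xstar)" and h_x: "h (x (Suc k)) = ereal (hr (x (Suc k)))" for k
    using hr xstar_fin p_fin x_Suc by simp_all
  define c where "c = (r - 1)\<^sup>2 / (2 * s)"
  text \<open>At \<open>k = 0\<close>, where \<open>h (x 0)\<close> may be infinite, \<open>\<delta>\<close> is a dummy that the recursion multiplies by \<open>0\<close>.\<close>
  define \<delta> where "\<delta> k = (if k = 0 then 0 else g (x k) + hr (x k) - (g xstar + hr xstar))" for k
  define z where "z k = ((real k + r - 1) *\<^sub>R y k - real k *\<^sub>R x k) /\<^sub>R (r - 1)" for k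
  define Z where "Z k = c * (norm (z k - xstar))\<^sup>2" for k
  have f_gap: "f (x (Suc k)) - f xstar = ereal (\<delta> (Suc k))" for k
    by (simp add: f h_x h_star \<delta>_def)
  have c: "0 < c"
    using r s by (simp add: c_def)
  have \<delta>_nonneg: "0 \<le> \<delta> k" for k
  proof (cases k)
    case (Suc j)
    have "f xstar \<le> f (x (Suc j))"
      using xstar by (auto simp: is_arg_min_def not_less)
    then show ?thesis
      by (simp add: Suc \<delta>_def f h_x h_star)
  qed (simp add: \<delta>_def)
  \<comment> \<open>The momentum coefficient is what makes this work: after extrapolation,
    \<open>x (Suc k)\<close> and \<open>x k\<close> occur with the same coefficients as
    \<open>y k\<close> and \<open>x k\<close> in \<open>z k\<close>, so only the displacement from
    \<open>y k\<close> to \<open>x (Suc k)\<close> remains.\<close>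
  have z_Suc: "z (Suc k) = z k - (s * (real k + r - 1) / (r - 1)) *\<^sub>R prox_subgrad s g h (y k)" for k
  proof -
    let ?G = "prox_subgrad s g h (y k)"
    have "(real (Suc k) + r - 1) *\<^sub>R y (Suc k)
        = (real (Suc k) + r - 1) *\<^sub>R x (Suc k) + real k *\<^sub>R (x (Suc k) - x k)"
      using y_rec[of "Suc k"] r by (simp add: scaleR_add_right)
    then have "(real (Suc k) + r - 1) *\<^sub>R y (Suc k) - real (Suc k) *\<^sub>R x (Suc k)
        = (real k + r - 1) *\<^sub>R x (Suc k) - real k *\<^sub>R x k"
      by (simp add: algebra_simps)
    also have "\<dots> = ((real k + r - 1) *\<^sub>R y k - real k *\<^sub>R x k) - (s * (real k + r - 1)) *\<^sub>R ?G"
      by (simp add: x_Suc algebra_simps)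
    finally show ?thesis
      by (simp add: z_def scaleR_diff_right divide_inverse mult.commute)
  qed
  have step: "(real k + r - 1)\<^sup>2 * \<delta> (Suc k) + Z (Suc k)
      \<le> real k * (real k + r - 1) * \<delta> k + Z k" for k
    unfolding Z_def c_def
  proof (rule accelerated_step[OF _ _ _ _ _ z_def z_Suc])
    let ?G = "prox_subgrad s g h (y k)"
    have prox: "g (x (Suc k)) + hr (x (Suc k))
        \<le> g v + hr v + ?G \<bullet> (y k - v) - s / 2 * (norm ?G)\<^sup>2" if "h v = ereal (hr v)" for v
      using proximal_gradient_inequality[OF g s conv _ h_x that] p_min[of "y k"] x_Suc by simp
    show "\<delta> (Suc k) \<le> ?G \<bullet> (y k - xstar) - s / 2 * (norm ?G)\<^sup>2"
      using prox[OF h_star] by (simp add: \<delta>_def)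
    \<comment> \<open>For positive \<open>k\<close> this is the proximal inequality at the previous
      iterate; at 0 both sides vanish.\<close>
    show "real k * \<delta> (Suc k)
        \<le> real k * (\<delta> k + ?G \<bullet> (y k - x k) - s / 2 * (norm ?G)\<^sup>2)"
    proof (cases k)
      case (Suc j)
      then show ?thesis
        using prox[OF h_x[of j]] by (intro mult_left_mono) (auto simp: \<delta>_def)
    qed simp
  qed (use r s in auto)
  have "z 0 = x0"
    using r init by (simp add: z_def)
  then have Z_0: "Z 0 = (r - 1)\<^sup>2 * (norm (x0 - xstar))\<^sup>2 / (2 * s)"
    by (simp add: Z_def c_def)
  have Z_nonneg: "0 \<le> Z k" for k
    using c by (simp add: Z_def)
  note bounds = lyapunov_bounds[OF r \<delta>_nonneg Z_nonneg step, unfolded Z_0]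
  show ?thesis
  proof (intro conjI allI impI)
    fix k :: nat
    assume "1 \<le> k"
    \<comment> \<open>The energy bound is indexed by the predecessor, which explains the shift to k
      + r - 2 in the rate.\<close>
    then obtain j where k: "k = Suc j"
      by (cases k) auto
    have "(real j + r - 1)\<^sup>2 > 0"
      using r by (intro zero_less_power) simp
    then have "\<delta> (Suc j) \<le> (r - 1)\<^sup>2 * (norm (x0 - xstar))\<^sup>2 / (2 * s) / (real j + r - 1)\<^sup>2"
      using bounds(1)[of j] by (subst pos_le_divide_eq) (simp_all only: mult.commute)
    moreover have "real k + r - 2 = real j + r - 1"
      by (simp add: k)
    ultimately show "f (x k) - f xstar
        \<le> ereal ((r - 1)\<^sup>2 * (norm (x0 - xstar))\<^sup>2 / (2 * s * (real k + r - 2)\<^sup>2))"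
      unfolding k f_gap by simp
  next
    show "(\<Sum>k. ereal (real (Suc k) + r - 1) * (f (x (Suc k)) - f xstar))
        \<le> ereal ((r - 1)\<^sup>2 * (norm (x0 - xstar))\<^sup>2 / (2 * s * (r - 3)))"
    \<comment> \<open>All terms are nonnegative, so a uniform bound on the partial sums passes to
      the extended real series.\<close>
    proof (intro suminf_bound allI)
      fix n
      have "(\<Sum>j<n. (real (Suc j) + r - 1) * \<delta> (Suc j))
          \<le> (r - 1)\<^sup>2 * (norm (x0 - xstar))\<^sup>2 / (2 * s) / (r - 3)"
        using bounds(2)[of n] r by (subst pos_le_divide_eq) (simp, simp only: mult.commute)
      then show "(\<Sum>k<n. ereal (real (Suc k) + r - 1) * (f (x (Suc k)) - f xstar))
          \<le> ereal ((r - 1)\<^sup>2 * (norm (x0 - xstar))\<^sup>2 / (2 * s * (r - 3)))"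
        by (simp add: f_gap)
    next
      fix n
      show "0 \<le> ereal (real (Suc n) + r - 1) * (f (x (Suc n)) - f xstar)"
        using r \<delta>_nonneg by (simp add: f_gap)
    qed
  qed
qed

end
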